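(* Let $p$ be an odd prime. Suppose that either $p = 40k_3 + 11$ for some integer $k_3$ such that $160k_3+49$ is a perfect square, or $p = 40k_4+19$ for some integer $k_4$ such that $160k_4+81$ is a perfect square. Then the elliptic curve $E_p : y^2 = x^3 - 5px$ has rank at least one over $\mathbb{Q}$.
   Context: The rank of an elliptic curve $E$ over a field $K$ is the rank $r$ of the finitely generated abelian group $E(K) \cong \mathbb{Z}^r \oplus E(K)_{\mathrm{tors}}$. *)

theory Defs
  imports
    "HOL-Algebra.Free_Abelian_Groups"
    "HOL-Computational_Algebra.Primes"
    "HOL-Library.Extended_Nat"
begin

datatype 'a ec_point = Infinity | Point 'a 'a

(* Chord-and-tangent law on the short Weierstrass curve y^2 = x^3 + a x + b.
   The coefficient b does not enter the formulas. *)
fun ec_add :: "'a::field_char_0 \<Rightarrow> 'a ec_point \<Rightarrow> 'a ec_point \<Rightarrow> 'a ec_point" where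
  "ec_add a Infinity Q = Q"
| "ec_add a (Point x y) Infinity = Point x y"
| "ec_add a (Point x1 y1) (Point x2 y2) =
     (if x1 = x2 \<and> y1 = - y2 then Infinity
      else
        let l = (if x1 = x2 then (3 * x1\<^sup>2 + a) / (2 * y1) else (y2 - y1) / (x2 - x1));
            x3 = l\<^sup>2 - x1 - x2
        in Point x3 (l * (x1 - x3) - y1))"

(* The group E(K) for E : y^2 = x^3 + a x + b and K the field 'a, meaningful as an
   elliptic curve when 4 a^3 + 27 b^2 is nonzero. *)
definition ec_group :: "'a::field_char_0 \<Rightarrow> 'a \<Rightarrow> 'a ec_point monoid" where
  "ec_group a b =
     \<lparr>carrier = insert Infinity {Point x y | x y. y\<^sup>2 = x ^ 3 + a * x + b},
      monoid.mult = ec_add a,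
      one = Infinity\<rparr>"

definition torsion_subgroup :: "('a, 'b) monoid_scheme \<Rightarrow> ('a, 'b) monoid_scheme" where
  "torsion_subgroup G =
     G\<lparr>carrier := {x \<in> carrier G. \<exists>n::nat. n > 0 \<and> x [^]\<^bsub>G\<^esub> n = \<one>\<^bsub>G\<^esub>}\<rparr>"

(* The rank of an abelian group G is the r with G \<cong> Z^r \<times> G_tors. For finitely generated G
   such an r exists and is unique, so the infimum ranges over a singleton. If there is no such
   r, then the infimum is \<infinity>; by the Mordell-Weil theorem this does not occur for the group of
   rational points of an elliptic curve over the rationals. *)
definition group_rank :: "('a, 'b) monoid_scheme \<Rightarrow> enat" where
  "group_rank G =
     (INF r \<in> {r::nat. G \<cong> product_group {..<r} (\<lambda>_. integer_group) \<times>\<times> torsion_subgroup G}.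
        enat r)"

end

theory Submission
  imports Defs
begin

text \<open>In both cases \<open>4 p + 5 = m\<^sup>2\<close> with m odd, and
  \<open>x (x\<^sup>2 - 5 p)\<close> is the square of \<open>m (m\<^sup>2 - 10) / 8\<close> at \<open>x = m\<^sup>2 / 4\<close>. The resulting point P
  satisfies v(x(P)) = -2 for the 2-adic valuation v. From the addition formulas, v(x(nP)) = -2
  for odd n, whereas for even n either nP = 0 or v(x(nP)) \<open>\<le>\<close> -4. If n > 0 is minimal with
  nP = 0, then n = 2k is even and kP = -kP has y = 0, which the valuation forbids; so P has
  infinite order. A rank of 0 would make every point torsion.\<close>

section \<open>Rank and elements of infinite order\<close>

text \<open>For r = 0 the free factor is trivial, so G would be isomorphic to its torsion part and
  every element would have finite order. Hence each admissible r is positive; an empty set of r has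
  infimum \<infinity>. The hypotheses ask for closure and a unit, which for \<open>ec_group\<close>
  come from the explicit formulas.\<close>

lemma group_rank_ge_1:
  fixes G :: "('a, 'b) monoid_scheme" (structure)
  assumes closed: "\<And>x y. x \<in> carrier G \<Longrightarrow> y \<in> carrier G \<Longrightarrow> x \<otimes> y \<in> carrier G"
    and one: "\<one> \<in> carrier G"
    and l_one: "\<And>x. x \<in> carrier G \<Longrightarrow> \<one> \<otimes> x = x"
    and r_one: "\<And>x. x \<in> carrier G \<Longrightarrow> x \<otimes> \<one> = x"
    and x: "x \<in> carrier G" "\<And>n::nat. n > 0 \<Longrightarrow> x [^] n \<noteq> \<one>"
  shows "group_rank G \<ge> 1"
proof -
  have no_iso: False if iso: "G \<cong> product_group {..<0::nat} (\<lambda>_. integer_group) \<times>\<times> torsion_subgroup G"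
  proof -
    let ?H = "product_group {..<0::nat} (\<lambda>_. integer_group) \<times>\<times> torsion_subgroup G"
    obtain \<phi> where \<phi>: "\<phi> \<in> iso G ?H"
      using iso unfolding is_iso_def by blast
    define \<psi> where "\<psi> = snd \<circ> \<phi>"
    have hom: "\<phi> (g \<otimes> h) = \<phi> g \<otimes>\<^bsub>?H\<^esub> \<phi> h" if "g \<in> carrier G" "h \<in> carrier G" for g h
      using \<phi> that by (auto simp: iso_def hom_def)
    have in_H: "\<phi> g \<in> carrier ?H" if "g \<in> carrier G" for g
      using \<phi> that by (auto simp: iso_def hom_def)
    \<comment> \<open>The only extensional function on the empty index set is
      \<open>\<lambda>_. undefined\<close>, so \<phi> is determined by \<psi>.\<close>
    have fst_\<phi>: "fst (\<phi> g) = (\<lambda>_. undefined)" if "g \<in> carrier G" for g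
      using in_H[OF that] by (auto simp: carrier_product_group DirProd_def)
    have \<psi>_tors: "\<psi> g \<in> carrier (torsion_subgroup G)" if "g \<in> carrier G" for g
      using in_H[OF that] by (auto simp: DirProd_def \<psi>_def)
    have \<psi>_in: "\<psi> g \<in> carrier G" if "g \<in> carrier G" for g
      using \<psi>_tors[OF that] by (auto simp: torsion_subgroup_def)
    have \<psi>_mult: "\<psi> (g \<otimes> h) = \<psi> g \<otimes> \<psi> h" if "g \<in> carrier G" "h \<in> carrier G" for g h
      using hom[OF that] by (auto simp: \<psi>_def DirProd_def torsion_subgroup_def split: prod.splits)
    have "\<one> [^] (1::nat) = \<one>"
      using l_one one by (simp add: nat_pow_def)
    then have "\<one> \<in> carrier (torsion_subgroup G)"
      using one zero_less_one unfolding torsion_subgroup_def by fastforce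
    then have "((\<lambda>_. undefined), \<one>) \<in> carrier ?H"
      by (auto simp: DirProd_def carrier_product_group)
    \<comment> \<open>Surjectivity gives g above the unit; then \<psi>(1) = \<psi>(1) \<psi>(g) =
      \<psi>(1 g) = \<psi>(g) = 1 takes the place of cancellation.\<close>
    then obtain g where g: "g \<in> carrier G" "\<phi> g = ((\<lambda>_. undefined), \<one>)"
      using \<phi> by (metis (no_types, lifting) iso_def bij_betw_imp_surj_on imageE mem_Collect_eq)
    have "\<psi> \<one> \<otimes> \<one> = \<one>"
      using \<psi>_mult[OF one g(1)] g l_one[OF g(1)] by (simp add: \<psi>_def)
    then have \<psi>_one: "\<psi> \<one> = \<one>"
      using r_one[OF \<psi>_in[OF one]] by simp
    have pow_in: "x [^] n \<in> carrier G" for n :: nat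
      by (induction n) (auto simp: nat_pow_def closed one x)
    have \<psi>_pow: "\<psi> (x [^] n) = \<psi> x [^] n" for n :: nat
    proof (induction n)
      case 0
      then show ?case by (simp add: nat_pow_def \<psi>_one)
    next
      case (Suc n)
      then show ?case using \<psi>_mult[OF pow_in x(1), of n] by (simp add: nat_pow_def)
    qed
    obtain n :: nat where n: "n > 0" "\<psi> x [^] n = \<one>"
      using \<psi>_tors[OF x(1)] by (auto simp: torsion_subgroup_def)
    have "\<psi> (x [^] n) = \<psi> \<one>"
      using n \<psi>_pow \<psi>_one by simp
    then have "\<phi> (x [^] n) = \<phi> \<one>"
      using fst_\<phi>[OF pow_in] fst_\<phi>[OF one] by (simp add: \<psi>_def prod_eq_iff)
    moreover have "inj_on \<phi> (carrier G)"
      using \<phi> by (auto simp: iso_def bij_betw_def)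
    ultimately have "x [^] n = \<one>"
      using pow_in one by (auto dest: inj_onD)
    with x n show False by blast
  qed
  have "r \<noteq> 0" if "G \<cong> product_group {..<r} (\<lambda>_. integer_group) \<times>\<times> torsion_subgroup G"
    for r :: nat
    using no_iso that by metis
  then show ?thesis
    unfolding group_rank_def
    by (intro INF_greatest) (auto simp: one_enat_def Suc_le_eq)
qed

section \<open>Chord-and-tangent law\<close>

text \<open>Two division-free equations for the slope treat chord and tangent alike. If x1 \<noteq>
  x2, the first determines l; otherwise it forces y1 = y2, nonzero, and the second determines
  l.\<close>

lemma ec_add_eqI:
  assumes "x1 \<noteq> x2 \<or> y1 \<noteq> - y2"
    and "l * (x2 - x1) = y2 - y1" and "l * (y1 + y2) = x1\<^sup>2 + x1 * x2 + x2\<^sup>2 + a"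
  shows "ec_add a (Point x1 y1) (Point x2 y2) =
    Point (l\<^sup>2 - x1 - x2) (l * (x1 - (l\<^sup>2 - x1 - x2)) - y1)"
proof -
  have "l = (if x1 = x2 then (3 * x1\<^sup>2 + a) / (2 * y1) else (y2 - y1) / (x2 - x1))"
    using assms by (auto simp: field_simps power2_eq_square)
  with assms(1) show ?thesis
    by (simp only: ec_add.simps Let_def) auto
qed

text \<open>For a chord, the second equation times x2 - x1 is the difference of the two curve
  equations.\<close>

lemma ec_slope_exists:
  fixes x1 :: "'a::field_char_0"
  assumes "x1 \<noteq> x2 \<or> y1 \<noteq> - y2"
    and "y1\<^sup>2 = x1 ^ 3 + a * x1 + b" "y2\<^sup>2 = x2 ^ 3 + a * x2 + b"
  obtains l where "l * (x2 - x1) = y2 - y1" "l * (y1 + y2) = x1\<^sup>2 + x1 * x2 + x2\<^sup>2 + a"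
proof (cases "x1 = x2")
  case True
  then have "(y1 - y2) * (y1 + y2) = 0"
    using assms by (simp add: algebra_simps power2_eq_square)
  then have "y1 = y2" "y1 \<noteq> 0"
    using assms True by (auto simp: add_eq_0_iff2)
  then show ?thesis
    using True that[of "(3 * x1\<^sup>2 + a) / (2 * y1)"] by (simp add: field_simps power2_eq_square)
next
  case False
  define l where "l = (y2 - y1) / (x2 - x1)"
  have l: "l * (x2 - x1) = y2 - y1"
    using False by (simp add: l_def)
  have "(x2 - x1) * (l * (y1 + y2)) = (x2 - x1) * (x1\<^sup>2 + x1 * x2 + x2\<^sup>2 + a)"
    using l assms(2,3) by algebra
  then show ?thesis
    using False l that by simp
qed

text \<open>Substituting the line of slope l through (x1, y1) into the curve equation leaves a monic
  cubic with roots x1, x2 and l^2 - x1 - x2; (x3, y3) is the reflected third intersection.\<close>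

lemma ec_add_on_curve:
  assumes "l * (x2 - x1) = y2 - y1" "l * (y1 + y2) = x1\<^sup>2 + x1 * x2 + x2\<^sup>2 + a"
    and "y1\<^sup>2 = x1 ^ 3 + a * x1 + b"
    and "x3 = l\<^sup>2 - x1 - x2" "y3 = l * (x1 - x3) - (y1 :: 'a::field_char_0)"
  shows "y3\<^sup>2 = x3 ^ 3 + a * x3 + b"
  using assms by algebra

fun ec_neg :: "'a::field_char_0 ec_point \<Rightarrow> 'a ec_point" where
  "ec_neg Infinity = Infinity"
| "ec_neg (Point x y) = Point x (- y)"

lemma ec_group_simps:
  "monoid.mult (ec_group a b) = ec_add a" "one (ec_group a b) = Infinity"
  "Infinity \<in> carrier (ec_group a b)"
  "Point x y \<in> carrier (ec_group a b) \<longleftrightarrow> y\<^sup>2 = x ^ 3 + a * x + b"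
  by (auto simp: ec_group_def)

lemma ec_add_Infinity_right [simp]: "ec_add a P Infinity = P"
  by (cases P) auto

lemma ec_add_closed:
  assumes "P \<in> carrier (ec_group a b)" "Q \<in> carrier (ec_group a b)"
  shows "ec_add a P Q \<in> carrier (ec_group a b)"
proof (cases "P = Infinity \<or> Q = Infinity")
  case True
  then show ?thesis using assms by auto
next
  case False
  then obtain x1 y1 x2 y2 where PQ: "P = Point x1 y1" "Q = Point x2 y2"
    by (meson ec_point.exhaust)
  show ?thesis
  proof (cases "x1 = x2 \<and> y1 = - y2")
    case True
    then show ?thesis by (simp add: PQ ec_group_simps)
  next
    case False
    then obtain l where l: "l * (x2 - x1) = y2 - y1"
        "l * (y1 + y2) = x1\<^sup>2 + x1 * x2 + x2\<^sup>2 + a"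
      using ec_slope_exists[of x1 x2 y1 y2 a b] assms by (auto simp: PQ ec_group_simps)
    then show ?thesis
      using ec_add_eqI[OF _ l] ec_add_on_curve[OF l _ refl refl] False assms
      by (auto simp: PQ ec_group_simps)
  qed
qed

text \<open>Reflection in the x-axis negates the slope and leaves its square, hence the new
  abscissa, unchanged.\<close>

lemma ec_add_neg: "ec_add a (ec_neg P) (ec_neg Q) = ec_neg (ec_add a P Q)"
proof (cases "P = Infinity \<or> Q = Infinity")
  case True
  then show ?thesis by auto
next
  case False
  then obtain x1 y1 x2 y2 where PQ: "P = Point x1 y1" "Q = Point x2 y2"
    by (meson ec_point.exhaust)
  define l where "l = (if x1 = x2 then (3 * x1\<^sup>2 + a) / (2 * y1) else (y2 - y1) / (x2 - x1))"
  have l': "- l = (if x1 = x2 then (3 * x1\<^sup>2 + a) / (2 * - y1) else (- y2 - - y1) / (x2 - x1))"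
    by (simp add: l_def minus_divide_left)
  have "- y1 = - (- y2) \<longleftrightarrow> y1 = - y2"
    by (rule neg_equal_iff_equal)
  then show ?thesis
    unfolding PQ ec_neg.simps ec_add.simps Let_def l_def[symmetric] l'[symmetric]
    by (simp add: algebra_simps)
qed

text \<open>Q, P and -(Q + P) lie on a line of slope l. The reflected line, of slope -l, passes
  through Q + P, -P and -Q, so adding -P to Q + P returns Q.\<close>

lemma ec_add_neg_cancel:
  assumes "P = Point x2 y2" "y2 \<noteq> 0"
    and "P \<in> carrier (ec_group a b)" "Q \<in> carrier (ec_group a b)"
  shows "ec_add a (ec_add a Q P) (ec_neg P) = Q"
proof (cases Q)
  case Infinity
  then show ?thesis using assms by simp
next
  case (Point x1 y1)
  show ?thesis
  proof (cases "x1 = x2 \<and> y1 = - y2")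
    case True
    then show ?thesis by (simp add: assms Point)
  next
    case False
    then obtain l where l: "l * (x2 - x1) = y2 - y1"
        "l * (y1 + y2) = x1\<^sup>2 + x1 * x2 + x2\<^sup>2 + a"
      using ec_slope_exists[of x1 x2 y1 y2 a b] assms by (auto simp: Point ec_group_simps)
    define x3 where "x3 = l\<^sup>2 - x1 - x2"
    define y3 where "y3 = l * (x1 - x3) - y1"
    have sum: "ec_add a Q P = Point x3 y3"
      using ec_add_eqI[OF _ l] False by (auto simp: Point assms x3_def y3_def)
    \<comment> \<open>P lies on the same line. If x3 = x2, this gives y3 = - y2, which differs from
      y2 as y2 is nonzero; so Q + P and -P are not opposite.\<close>
    have y3: "y3 = l * (x2 - x3) - y2"
      using l y3_def by algebra
    then have "x3 \<noteq> x2 \<or> y3 \<noteq> - (- y2)"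
      using assms(2) by auto
    moreover have "(- l) * (x2 - x3) = - y2 - y3"
      using y3 by algebra
    moreover have "(- l) * (y3 + - y2) = x3\<^sup>2 + x3 * x2 + x2\<^sup>2 + a"
      using l x3_def y3_def by algebra
    ultimately have "ec_add a (Point x3 y3) (Point x2 (- y2)) =
        Point ((- l)\<^sup>2 - x3 - x2) ((- l) * (x3 - ((- l)\<^sup>2 - x3 - x2)) - y3)"
      by (rule ec_add_eqI)
    also have "(- l)\<^sup>2 - x3 - x2 = x1"
      by (simp add: x3_def)
    also have "(- l) * (x3 - x1) - y3 = y1"
      by (simp add: y3_def algebra_simps)
    finally show ?thesis
      unfolding sum by (simp only: assms(1) Point ec_neg.simps)
  qed
qed

text \<open>The symmetry needs only \<open>(Q + P) - P = Q\<close>, not the associative law.\<close>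

lemma ec_pow_sym:
  assumes "P = Point x2 y2" "y2 \<noteq> 0" "P \<in> carrier (ec_group a b)"
    and "P [^]\<^bsub>ec_group a b\<^esub> (n::nat) = Infinity" "k \<le> n"
  shows "P [^]\<^bsub>ec_group a b\<^esub> (n - k) = ec_neg (P [^]\<^bsub>ec_group a b\<^esub> k)"
  using assms(5)
proof (induction k)
  case 0
  then show ?case using assms(4) by (simp add: nat_pow_def ec_group_simps)
next
  case (Suc k)
  let ?p = "\<lambda>n::nat. P [^]\<^bsub>ec_group a b\<^esub> n"
  have zero: "?p 0 = Infinity" and step: "?p (Suc j) = ec_add a (?p j) P" for j
    by (simp_all add: nat_pow_def ec_group_simps)
  have in_carrier: "?p j \<in> carrier (ec_group a b)" for j
    by (induction j) (simp_all only: zero step ec_add_closed assms(3) ec_group_simps)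
  have "n - k = Suc (n - Suc k)"
    using Suc by simp
  then have "ec_add a (?p (n - Suc k)) P = ec_neg (?p k)"
    using Suc step by simp
  then have "?p (n - Suc k) = ec_add a (ec_neg (?p k)) (ec_neg P)"
    using ec_add_neg_cancel[OF assms(1-3) in_carrier, of "n - Suc k"] by simp
  then show ?case
    by (simp only: ec_add_neg step)
qed

section \<open>2-adic valuation on the rationals\<close>

text \<open>A relation instead of a function: 0 has no valuation, so \<open>val2 q e\<close> also
  records that q is nonzero.\<close>

definition val2 :: "rat \<Rightarrow> int \<Rightarrow> bool" where
  "val2 q e \<longleftrightarrow> (\<exists>c d. odd c \<and> odd d \<and> q = of_int c / of_int d * 2 powi e)"

lemma val2I: "odd c \<Longrightarrow> odd d \<Longrightarrow> q = of_int c / of_int d * 2 powi e \<Longrightarrow> val2 q e"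
  unfolding val2_def by blast

lemma val2E:
  assumes "val2 q e"
  obtains c d where "odd c" "odd d" "q = of_int c / of_int d * 2 powi e"
  using assms unfolding val2_def by blast

lemma val2_nonzero: "val2 q e \<Longrightarrow> q \<noteq> 0"
  by (auto elim!: val2E)

lemma val2_uminus: "val2 q e \<Longrightarrow> val2 (- q) e"
  by (erule val2E, rule val2I[of "- c" d for c d]) auto

lemma val2_mult:
  assumes "val2 q e" "val2 r f"
  shows "val2 (q * r) (e + f)"
proof -
  obtain c d where 1: "odd c" "odd d" "q = of_int c / of_int d * 2 powi e"
    using assms(1) by (rule val2E)
  obtain c' d' where 2: "odd c'" "odd d'" "r = of_int c' / of_int d' * 2 powi f"
    using assms(2) by (rule val2E)
  show ?thesis
    by (rule val2I[of "c * c'" "d * d'"]) (use 1 2 in \<open>auto simp: power_int_add\<close>)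
qed

lemma val2_inverse:
  assumes "val2 q e"
  shows "val2 (inverse q) (- e)"
proof -
  obtain c d where 1: "odd c" "odd d" "q = of_int c / of_int d * 2 powi e"
    using assms(1) by (rule val2E)
  show ?thesis
    by (rule val2I[of d c]) (use 1 in \<open>auto simp: power_int_minus field_simps\<close>)
qed

lemma val2_divide: "val2 q e \<Longrightarrow> val2 r f \<Longrightarrow> val2 (q / r) (e - f)"
  using val2_mult[OF _ val2_inverse] by (simp add: divide_inverse)

lemma val2_power: "val2 q e \<Longrightarrow> val2 (q ^ n) (int n * e)"
proof (induction n)
  case 0
  show ?case by (rule val2I[of 1 1]) auto
next
  case (Suc n)
  then show ?case using val2_mult[OF Suc.prems Suc.IH] by (simp add: algebra_simps)
qed

text \<open>Over a common denominator the numerator is odd plus even: the larger valuation leaves a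
  factor 2^n with n > 0.\<close>

lemma val2_add:
  assumes "val2 q e" "val2 r f" "e < f"
  shows "val2 (q + r) e"
proof -
  obtain c d where 1: "odd c" "odd d" "q = of_int c / of_int d * 2 powi e"
    using assms(1) by (rule val2E)
  obtain c' d' where 2: "odd c'" "odd d'" "r = of_int c' / of_int d' * 2 powi f"
    using assms(2) by (rule val2E)
  define n where "n = nat (f - e)"
  have n: "f = e + int n" "n > 0"
    using assms(3) by (auto simp: n_def)
  show ?thesis
  proof (rule val2I[of "c * d' + c' * d * 2 ^ n" "d * d'"])
    have [simp]: "d \<noteq> 0" "d' \<noteq> 0" using 1 2 by auto
    show "q + r = of_int (c * d' + c' * d * 2 ^ n) / of_int (d * d') * 2 powi e"
      by (simp add: 1 2 n power_int_add field_simps)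
  qed (use 1 2 n in auto)
qed

lemma val2_of_int:
  assumes "n \<noteq> 0"
  obtains e where "val2 (of_int n) e" "e \<ge> 0"
proof -
  obtain k where k: "n = 2 ^ multiplicity 2 n * k" "\<not> 2 dvd k"
    using multiplicity_decompose'[of n 2] assms odd_one by blast
  have "val2 (of_int n) (int (multiplicity 2 n))"
  proof (rule val2I[of k 1])
    have "(of_int n :: rat) = of_int (2 ^ multiplicity 2 n * k)"
      using k(1) by simp
    then show "of_int n = of_int k / of_int 1 * (2 :: rat) powi int (multiplicity 2 n)"
      by simp
  qed (use k in auto)
  then show ?thesis using that by simp
qed

lemma val2_exists:
  assumes "q \<noteq> 0"
  obtains e where "val2 q e"
proof -
  obtain a b where q: "q = of_int a / of_int b" "b > 0"
    by (metis quotient_of_div quotient_of_denom_pos prod.collapse)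
  then show ?thesis
    using assms val2_of_int[of a] val2_of_int[of b] val2_divide that
    by (metis div_0 of_int_0 less_irrefl)
qed

text \<open>If e < f were both valuations of q, then q + (-q) = 0 would have valuation e.\<close>

lemma val2_unique:
  assumes "val2 q e" "val2 q f"
  shows "e = f"
proof -
  have *: "\<not> e < f" if "val2 q e" "val2 q f" for e f q
    using val2_nonzero[OF val2_add[OF that(1) val2_uminus[OF that(2)]]] by auto
  show ?thesis using *[of q e f] *[of q f e] assms by force
qed

text \<open>Special to the prime 2: the sum of two odd numerators is even, so equal valuations
  always gain at least 1.\<close>

lemma val2_add_same:
  assumes "val2 q e" "val2 r e" "q + r \<noteq> 0"
  obtains f where "val2 (q + r) f" "f > e"
proof -
  obtain c d where 1: "odd c" "odd d" "q = of_int c / of_int d * 2 powi e"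
    using assms(1) by (rule val2E)
  obtain c' d' where 2: "odd c'" "odd d'" "r = of_int c' / of_int d' * 2 powi e"
    using assms(2) by (rule val2E)
  have "even (c * d' + c' * d)" using 1 2 by simp
  then obtain k where k: "c * d' + c' * d = 2 * k" by (rule evenE)
  have [simp]: "d \<noteq> 0" "d' \<noteq> 0" using 1 2 by auto
  have eq: "q + r = of_int (c * d' + c' * d) / of_int (d * d') * 2 powi e"
    by (simp add: 1 2 field_simps)
  with k assms(3) have "k \<noteq> 0" by auto
  then obtain g where g: "val2 (of_int k) g" "g \<ge> 0" by (rule val2_of_int)
  have "val2 (2 powi (e + 1) / of_int (d * d')) (e + 1)"
    by (rule val2I[of 1 "d * d'"]) (use 1 2 in auto)
  from val2_mult[OF g(1) this] have "val2 (q + r) (g + (e + 1))"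
    unfolding eq k by (simp add: power_int_add field_simps)
  with g that show ?thesis by force
qed

section \<open>2-adic layers of points on y^2 = x^3 + a x\<close>

text \<open>As v(x) < 0, the term x^2 dominates the integer a in y^2 = x (x^2 + a), so 2 v(y) = 3
  v(x).\<close>

lemma val2_curve_y:
  assumes "val2 x (- 2 * i)" "i > 0" "y\<^sup>2 = x ^ 3 + of_int a * x"
  shows "val2 y (- 3 * i)"
proof -
  have x2: "val2 (x\<^sup>2) (- 4 * i)"
    using val2_power[OF assms(1), of 2] by simp
  have "val2 (x\<^sup>2 + of_int a) (- 4 * i)"
  proof (cases "a = 0")
    case False
    then obtain e where "val2 (of_int a) e" "e \<ge> 0" by (rule val2_of_int)
    with x2 assms(2) show ?thesis by (intro val2_add[where f = e]) auto
  qed (use x2 in auto)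
  moreover have "y\<^sup>2 = x * (x\<^sup>2 + of_int a)"
    using assms(3) by algebra
  ultimately have y2: "val2 (y\<^sup>2) (- 6 * i)"
    using val2_mult[OF assms(1)] by fastforce
  then have "y \<noteq> 0" using val2_nonzero by fastforce
  then obtain e where e: "val2 y e" by (rule val2_exists)
  have "2 * e = - 6 * i"
    using val2_unique[OF val2_power[OF e, of 2] y2] by simp
  then have "e = - 3 * i" by simp
  with e show ?thesis by simp
qed

text \<open>In terms of the formal group parameter z = x / y at 2: \<^term>\<open>layer1\<close> is v(z) = 1 and
  \<^term>\<open>layer2\<close> is v(z) \<open>\<ge>\<close> 2.\<close>

definition layer1 :: "rat ec_point \<Rightarrow> bool" where
  "layer1 P \<longleftrightarrow> (\<exists>x y. P = Point x y \<and> val2 x (- 2))"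

definition layer2 :: "rat ec_point \<Rightarrow> bool" where
  "layer2 P \<longleftrightarrow> P = Infinity \<or> (\<exists>x y i. P = Point x y \<and> val2 x (- 2 * i) \<and> i \<ge> 2)"

text \<open>The slope is read off from l (y1 + y2), of valuation -4, since y2 - y1 and x2 - x1 both
  suffer cancellation. With v(y1 + y2) \<ge> -2 this gives v(l) \<le> -2, so l^2 dominates x1 + x2
  and v(x3) = 2 v(l) \<le> -4.\<close>

lemma ec_add_layer1_layer1:
  assumes "layer1 P" "layer1 Q"
    and "P \<in> carrier (ec_group (of_int a) 0)" "Q \<in> carrier (ec_group (of_int a) 0)"
  shows "layer2 (ec_add (of_int a) P Q)"
proof -
  obtain x1 y1 x2 y2 where PQ: "P = Point x1 y1" "Q = Point x2 y2"
    and x: "val2 x1 (- 2)" "val2 x2 (- 2)"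
    using assms by (auto simp: layer1_def)
  have curve: "y1\<^sup>2 = x1 ^ 3 + of_int a * x1" "y2\<^sup>2 = x2 ^ 3 + of_int a * x2"
    using assms by (auto simp: PQ ec_group_simps)
  show ?thesis
  proof (cases "x1 = x2 \<and> y1 = - y2")
    case True
    then show ?thesis by (simp add: PQ layer2_def)
  next
    case False
    then obtain l where l: "l * (x2 - x1) = y2 - y1"
        "l * (y1 + y2) = x1\<^sup>2 + x1 * x2 + x2\<^sup>2 + of_int a"
      using ec_slope_exists[of x1 x2 y1 y2 "of_int a" 0] curve by auto
    have y: "val2 y1 (- 3)" "val2 y2 (- 3)"
      using val2_curve_y[of _ 1] x curve by auto
    \<comment> \<open>Of three terms of equal valuation, two sum to 0 or to a higher valuation, so
      the third decides.\<close>
    have squares: "val2 (x1\<^sup>2 + x1 * x2 + x2\<^sup>2) (- 4)"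
    proof -
      have xx: "val2 (x1\<^sup>2) (- 4)" "val2 (x1 * x2) (- 4)" "val2 (x2\<^sup>2) (- 4)"
        using val2_power[OF x(1), of 2] val2_power[OF x(2), of 2] val2_mult[OF x] by auto
      show ?thesis
      proof (cases "x1\<^sup>2 + x1 * x2 = 0")
        case False
        then obtain f where "val2 (x1\<^sup>2 + x1 * x2) f" "f > - 4"
          using val2_add_same[OF xx(1,2)] by blast
        then have "val2 (x2\<^sup>2 + (x1\<^sup>2 + x1 * x2)) (- 4)"
          by (rule val2_add[OF xx(3)])
        then show ?thesis by (simp add: add.commute)
      qed (use xx in simp)
    qed
    then have num: "val2 (l * (y1 + y2)) (- 4)"
    proof (cases "a = 0")
      case False
      then obtain e where "val2 (of_int a) e" "e \<ge> 0" by (rule val2_of_int)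
      then show ?thesis
        unfolding l by (intro val2_add[OF squares, of _ e]) auto
    qed (use l squares in simp)
    then have "l * (y1 + y2) \<noteq> 0" by (rule val2_nonzero)
    then have nz: "l \<noteq> 0" "y1 + y2 \<noteq> 0" by auto
    obtain f where f: "val2 (y1 + y2) f" "f > - 3"
      using val2_add_same[OF y nz(2)] by blast
    obtain e where e: "val2 l e" using val2_exists nz by blast
    have "e + f = - 4" using val2_unique[OF val2_mult[OF e f(1)] num] .
    with f have e_le: "e \<le> - 2" by simp
    have l2: "val2 (l\<^sup>2) (2 * e)" using val2_power[OF e, of 2] by simp
    have "val2 (l\<^sup>2 - (x1 + x2)) (2 * e)"
    proof (cases "x1 + x2 = 0")
      case False
      then obtain g where "val2 (x1 + x2) g" "g > - 2"
        using val2_add_same[OF x] by blast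
      then show ?thesis
        using val2_add[OF l2 val2_uminus, of "x1 + x2" g] e_le
        by (simp only: diff_conv_add_uminus)
    qed (use l2 in simp)
    then have "val2 (l\<^sup>2 - x1 - x2) (- 2 * (- e))" by (simp add: algebra_simps)
    moreover have "- e \<ge> 2" using e_le by simp
    moreover have "ec_add (of_int a) P Q =
        Point (l\<^sup>2 - x1 - x2) (l * (x1 - (l\<^sup>2 - x1 - x2)) - y1)"
      unfolding PQ by (rule ec_add_eqI) (use False l in auto)
    ultimately show ?thesis
      unfolding layer2_def by blast
  qed
qed

lemma ec_add_layer2_layer1:
  assumes "layer2 P" "layer1 Q"
    and "P \<in> carrier (ec_group (of_int a) 0)" "Q \<in> carrier (ec_group (of_int a) 0)"
  shows "layer1 (ec_add (of_int a) P Q)"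
proof (cases "P = Infinity")
  case True
  then show ?thesis using assms by simp
next
  case False
  then obtain x1 y1 x2 y2 i where PQ: "P = Point x1 y1" "Q = Point x2 y2"
    and x: "val2 x1 (- 2 * i)" "i \<ge> 2" "val2 x2 (- 2)"
    using assms by (auto simp: layer1_def layer2_def)
  have curve: "y1\<^sup>2 = x1 ^ 3 + of_int a * x1" "y2\<^sup>2 = x2 ^ 3 + of_int a * x2"
    using assms by (auto simp: PQ ec_group_simps)
  have y: "val2 y1 (- 3 * i)" "val2 y2 (- 3)"
    using val2_curve_y[of _ 1] val2_curve_y[OF x(1)] x curve by auto
  have "x1 \<noteq> x2" using x val2_unique by fastforce
  then obtain l where l: "l * (x2 - x1) = y2 - y1"
      "l * (y1 + y2) = x1\<^sup>2 + x1 * x2 + x2\<^sup>2 + of_int a"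
    using ec_slope_exists[of x1 x2 y1 y2 "of_int a" 0] curve by auto
  define x3 where "x3 = l\<^sup>2 - x1 - x2"
  \<comment> \<open>In l^2 - x1 - x2 the leading parts of l^2 and x1 cancel. Since b = 0, the
    product of the roots helps instead: x1 x2 x3 is the square of the intercept (x2 y1 - x1 y2) /
    (x2 - x1) of the chord.\<close>
  have "(x2 - x1)\<^sup>2 * (x1 * x2 * x3) = (x2 * y1 - x1 * y2)\<^sup>2"
    using l curve x3_def by algebra
  then have x3: "x3 = ((x2 * y1 - x1 * y2) / (x2 - x1))\<^sup>2 / (x1 * x2)"
    using \<open>x1 \<noteq> x2\<close> val2_nonzero[OF x(1)] val2_nonzero[OF x(3)]
    by (simp add: field_simps)
  have "val2 (x2 * y1) (- 2 - 3 * i)" "val2 (- (x1 * y2)) (- 2 * i - 3)"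
    using val2_mult[OF x(3) y(1)] val2_uminus[OF val2_mult[OF x(1) y(2)]] by auto
  \<comment> \<open>Here i \<ge> 2 enters: it makes -2 - 3i strictly less than -2i - 3.\<close>
  then have num: "val2 (x2 * y1 - x1 * y2) (- 2 - 3 * i)"
    using val2_add[of "x2 * y1" _ "- (x1 * y2)"] x(2) by simp
  have den: "val2 (x2 - x1) (- 2 * i)"
    using val2_add[OF val2_uminus[OF x(1)] x(3)] x(2) by simp
  have "val2 x3 (- 2)"
    using val2_divide[OF val2_power[OF val2_divide[OF num den], of 2] val2_mult[OF x(1,3)]]
    by (simp add: x3 algebra_simps)
  moreover have "ec_add (of_int a) P Q = Point x3 (l * (x1 - x3) - y1)"
    unfolding PQ x3_def by (rule ec_add_eqI) (use \<open>x1 \<noteq> x2\<close> l in auto)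
  ultimately show ?thesis
    unfolding layer1_def by blast
qed

lemma layer1_infinite_order:
  assumes P: "layer1 P" "P \<in> carrier (ec_group (of_int a) 0)" and "n > 0"
  shows "P [^]\<^bsub>ec_group (of_int a) 0\<^esub> (n::nat) \<noteq> Infinity"
  using \<open>n > 0\<close>
proof (induction n rule: less_induct)
  case (less n)
  let ?p = "\<lambda>n::nat. P [^]\<^bsub>ec_group (of_int a) 0\<^esub> n"
  have zero: "?p 0 = Infinity" and step: "?p (Suc j) = ec_add (of_int a) (?p j) P" for j
    by (simp_all add: nat_pow_def ec_group_simps)
  have in_carrier: "?p j \<in> carrier (ec_group (of_int a) 0)" for j
    by (induction j) (simp_all only: zero step ec_add_closed P ec_group_simps)
  have layers: "if even j then layer2 (?p j) else layer1 (?p j)" for j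
  proof (induction j)
    case 0
    then show ?case by (simp only: zero) (simp add: layer2_def)
  next
    case (Suc j)
    then show ?case
      using ec_add_layer1_layer1 ec_add_layer2_layer1 P in_carrier
      by (auto simp only: step even_Suc split: if_splits)
  qed
  obtain x y where xy: "P = Point x y" "val2 x (- 2)"
    using P by (auto simp: layer1_def)
  \<comment> \<open>The cancellation behind \<open>ec_pow_sym\<close> asks for a nonzero
    ordinate.\<close>
  then have "y \<noteq> 0"
    using val2_curve_y[of x 1 y a] val2_nonzero P by (auto simp: ec_group_simps)
  show ?case
  proof
    assume inf: "?p n = Infinity"
    then have "even n"
      using layers[of n] by (auto simp: layer1_def split: if_splits)
    then obtain k where k: "n = k + k" "k > 0" "k < n"
      using less.prems by (metis evenE mult_2 add_gr_0 less_add_same_cancel1)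
    have "?p k = ec_neg (?p k)"
      using ec_pow_sym[OF xy(1) \<open>y \<noteq> 0\<close> P(2) inf, of k] k by simp
    \<comment> \<open>The induction hypothesis at k < n makes kP affine; it stands in for the
      minimality of n.\<close>
    moreover obtain u v where uv: "?p k = Point u v"
      using less.IH[OF k(3,2)] by (cases "?p k") auto
    ultimately have "v = 0" by (simp add: eq_neg_iff_add_eq_0)
    obtain i where i: "val2 u (- 2 * i)" "i > 0"
    proof -
      consider "layer1 (Point u v)" | "layer2 (Point u v)"
        using layers[of k] unfolding uv by presburger
      then show ?thesis
      proof cases
        case 1
        then show ?thesis using that[of 1] by (simp add: layer1_def)
      next
        case 2
        then show ?thesis using that by (force simp: layer2_def)
      qed
    qed
    have "val2 v (- 3 * i)"
      using val2_curve_y[OF i] in_carrier[of k] by (simp add: uv ec_group_simps)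
    with \<open>v = 0\<close> val2_nonzero show False by blast
  qed
qed

section \<open>A point of layer 1 on the curve\<close>

theorem theorem1p3:
  fixes p :: nat
  assumes "prime p" and "odd p"
    and "(\<exists>k\<^sub>3::int. int p = 40 * k\<^sub>3 + 11 \<and> (\<exists>m::int. 160 * k\<^sub>3 + 49 = m\<^sup>2)) \<or>
         (\<exists>k\<^sub>4::int. int p = 40 * k\<^sub>4 + 19 \<and> (\<exists>m::int. 160 * k\<^sub>4 + 81 = m\<^sup>2))"
  shows "group_rank (ec_group (- 5 * of_nat p :: rat) 0) \<ge> 1"
proof -
  \<comment> \<open>4 (40k + 11) + 5 = 160k + 49 and 4 (40k + 19) + 5 = 160k + 81.\<close>
  obtain m :: int where m: "m\<^sup>2 = 4 * int p + 5"
    using assms(3)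
  proof (elim disjE exE conjE)
    fix k m :: int
    assume "int p = 40 * k + 11" "160 * k + 49 = m\<^sup>2"
    then show thesis using that[of m] by simp
  next
    fix k m :: int
    assume "int p = 40 * k + 19" "160 * k + 81 = m\<^sup>2"
    then show thesis using that[of m] by simp
  qed
  then have "odd (m\<^sup>2)" by simp
  define a :: int where "a = - 5 * int p"
  have a: "(- 5 * of_nat p :: rat) = of_int a"
    by (simp add: a_def)
  \<comment> \<open>Both factors of x (x^2 - 5p) become squares: x = (m/2)^2, and 80p = 20 m^2 - 100
    gives 16 (x^2 - 5p) = m^4 - 20 m^2 + 100 = (m^2 - 10)^2.\<close>
  define x y :: rat where "x = of_int (m\<^sup>2) / 4" and "y = of_int (m * (m\<^sup>2 - 10)) / 8"
  have "of_int (m\<^sup>2) = (of_int (4 * int p + 5) :: rat)"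
    by (simp only: m)
  then have "(of_int m)\<^sup>2 = 4 * of_nat p + (5 :: rat)"
    by simp
  then have "y\<^sup>2 = x ^ 3 + of_int a * x"
    by (simp add: x_def y_def a_def power_divide field_simps) algebra
  then have "Point x y \<in> carrier (ec_group (of_int a) 0)"
    by (simp add: ec_group_simps)
  moreover have "val2 x (- 2)"
    using val2I[of "m\<^sup>2" 1 x "- 2"] \<open>odd (m\<^sup>2)\<close> by (simp add: x_def power_int_minus)
  then have "layer1 (Point x y)"
    by (simp add: layer1_def)
  ultimately show ?thesis
    unfolding a
    by (intro group_rank_ge_1[where x = "Point x y"])
      (auto simp: ec_group_simps(1-3) ec_add_closed layer1_infinite_order)
qed

end
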